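(* Let $k$ be a commutative ring, and let $F:\mathcal{C}\to\mathcal{B}$ and $G:\mathcal{D}\to\mathcal{B}$ be $k$-functors of $k$-categories. Assume that $F$ is a covering and that $G$ is fully faithful. Then the projection functor $\mathsf{pr}_{\mathcal{D}}:\mathcal{C}\times_{\mathcal{B}}\mathcal{D}\to\mathcal{D}$ from the fibre product is a covering of $\mathcal{D}$.
   Context: A $k$-category $\mathcal{B}$ is a small category with object set $\mathcal{B}_0$ such that each morphism set ${}_y\mathcal{B}_x$ (morphisms from $x$ to $y$) is a $k$-module and composition is $k$-bilinear. A $k$-functor is a $k$-linear functor. The star of $\mathcal{B}$ at an object $b$ is the $k$-module $\mathsf{St}_b\mathcal{B}=\left(\bigoplus_{y\in\mathcal{B}_0}{}_y\mathcal{B}_b\right)\oplus\left(\bigoplus_{y\in\mathcal{B}_0}{}_b\mathcal{B}_y\right)$. A $k$-functor $F:\mathcal{C}\to\mathcal{B}$ is a covering (of $\mathcal{B}$) if it is surjective on objects and, for each $b\in\mathcal{B}_0$ and each object $x\in F^{-1}(b)$, the map $\mathsf{St}_x\mathcal{C}\to\mathsf{St}_b\mathcal{B}$ induced by $F$ is an isomorphism of $k$-modules. Given $k$-functors $F:\mathcal{C}\to\mathcal{B}$ and $G:\mathcal{D}\to\mathcal{B}$, the fibre product $\mathcal{C}\times_{\mathcal{B}}\mathcal{D}$ is the $k$-category whose objects are the pairs $(x,y)\in\mathcal{C}_0\times\mathcal{D}_0$ with $F(x)=G(y)$, whose morphisms from $(x,y)$ to $(x',y')$ form the $k$-submodule of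 ${}_{x'}\mathcal{C}_x\oplus{}_{y'}\mathcal{D}_y$ of pairs $(\varphi,\psi)$ with $F\varphi=G\psi$, and whose composition is componentwise. The functor $\mathsf{pr}_{\mathcal{D}}$ is the projection to the second component. *)

theory Defs
  imports "HOL-Algebra.Module"
begin

section \<open>Modules\<close>

text \<open>
  The record of modules extends the record of rings. The multiplication and the unit of a module
  play no role in the locale \<^locale>\<open>module\<close>, so they are left unspecified below.
\<close>

definition linear_maps ::
  "('k, 'r) ring_scheme \<Rightarrow> ('k, 'm, 'x) module_scheme \<Rightarrow> ('k, 'n, 'y) module_scheme \<Rightarrow> ('m \<Rightarrow> 'n) set"
  where "linear_maps R M N =
    {h \<in> carrier M \<rightarrow> carrier N.
      (\<forall>u\<in>carrier M. \<forall>v\<in>carrier M. h (u \<oplus>\<^bsub>M\<^esub> v) = h u \<oplus>\<^bsub>N\<^esub> h v) \<and>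
      (\<forall>a\<in>carrier R. \<forall>u\<in>carrier M. h (a \<odot>\<^bsub>M\<^esub> u) = a \<odot>\<^bsub>N\<^esub> h u)}"

definition module_isos ::
  "('k, 'r) ring_scheme \<Rightarrow> ('k, 'm, 'x) module_scheme \<Rightarrow> ('k, 'n, 'y) module_scheme \<Rightarrow> ('m \<Rightarrow> 'n) set"
  where "module_isos R M N = {h \<in> linear_maps R M N. bij_betw h (carrier M) (carrier N)}"

definition module_prod ::
  "('k, 'm, 'x) module_scheme \<Rightarrow> ('k, 'n, 'y) module_scheme \<Rightarrow> ('k, 'm \<times> 'n) module"
  where "module_prod M N =
    \<lparr>carrier = carrier M \<times> carrier N, mult = undefined, one = undefined,
     zero = (\<zero>\<^bsub>M\<^esub>, \<zero>\<^bsub>N\<^esub>),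
     add = (\<lambda>(u, v) (u', v'). (u \<oplus>\<^bsub>M\<^esub> u', v \<oplus>\<^bsub>N\<^esub> v')),
     smult = (\<lambda>a (u, v). (a \<odot>\<^bsub>M\<^esub> u, a \<odot>\<^bsub>N\<^esub> v))\<rparr>"

definition direct_sum ::
  "'i set \<Rightarrow> ('i \<Rightarrow> ('k, 'm, 'x) module_scheme) \<Rightarrow> ('k, 'i \<Rightarrow> 'm) module"
  where "direct_sum I M =
    \<lparr>carrier = {u \<in> \<Pi>\<^sub>E i\<in>I. carrier (M i). finite {i \<in> I. u i \<noteq> \<zero>\<^bsub>M i\<^esub>}},
     mult = undefined, one = undefined,
     zero = (\<lambda>i\<in>I. \<zero>\<^bsub>M i\<^esub>),
     add = (\<lambda>u v. \<lambda>i\<in>I. u i \<oplus>\<^bsub>M i\<^esub> v i),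
     smult = (\<lambda>a u. \<lambda>i\<in>I. a \<odot>\<^bsub>M i\<^esub> u i)\<rparr>"

text \<open>
  The map between direct sums that sends the summand with index \<open>i\<close> to the summand with index
  \<open>r i\<close> by means of \<open>h i\<close>. The sum runs over the support of \<open>u\<close> because \<^const>\<open>finsum\<close> is
  zero by convention over infinite index sets.
\<close>

definition direct_sum_map ::
  "'i set \<Rightarrow> ('i \<Rightarrow> ('k, 'm, 'x) module_scheme) \<Rightarrow> 'j set \<Rightarrow> ('j \<Rightarrow> ('k, 'n, 'y) module_scheme) \<Rightarrow>
    ('i \<Rightarrow> 'j) \<Rightarrow> ('i \<Rightarrow> 'm \<Rightarrow> 'n) \<Rightarrow> ('i \<Rightarrow> 'm) \<Rightarrow> ('j \<Rightarrow> 'n)"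
  where "direct_sum_map I M J N r h =
    (\<lambda>u. \<lambda>j\<in>J. finsum (N j) (\<lambda>i. h i (u i)) {i \<in> I. r i = j \<and> u i \<noteq> \<zero>\<^bsub>M i\<^esub>})"

section \<open>Categories and functors over a commutative ring\<close>

text \<open>
  \<open>Hom C x y\<close> is the module of morphisms from \<open>x\<close> to \<open>y\<close>, written \<open>yCx\<close> (with lower indices) in
  the literature on coverings. Different morphism modules may share elements, hence composition
  takes the objects as arguments: \<open>Comp C x y z g f\<close> is \<open>g\<close> after \<open>f\<close>
  for \<open>f\<close> from \<open>x\<close> to \<open>y\<close> and \<open>g\<close> from \<open>y\<close> to \<open>z\<close>.
\<close>

record ('o, 'k, 'm) kcat =
  Obj :: "'o set"
  Hom :: "'o \<Rightarrow> 'o \<Rightarrow> ('k, 'm) module"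
  Id :: "'o \<Rightarrow> 'm"
  Comp :: "'o \<Rightarrow> 'o \<Rightarrow> 'o \<Rightarrow> 'm \<Rightarrow> 'm \<Rightarrow> 'm"

locale k_category = cring R
  for R :: "('k, 'r) ring_scheme" (structure) and C :: "('o, 'k, 'm) kcat" +
  assumes Hom_module: "\<lbrakk>x \<in> Obj C; y \<in> Obj C\<rbrakk> \<Longrightarrow> module R (Hom C x y)"
    and Id_closed: "x \<in> Obj C \<Longrightarrow> Id C x \<in> carrier (Hom C x x)"
    and Comp_linear_left:
      "\<lbrakk>x \<in> Obj C; y \<in> Obj C; z \<in> Obj C; f \<in> carrier (Hom C x y)\<rbrakk> \<Longrightarrow>
        (\<lambda>g. Comp C x y z g f) \<in> linear_maps R (Hom C y z) (Hom C x z)"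
    and Comp_linear_right:
      "\<lbrakk>x \<in> Obj C; y \<in> Obj C; z \<in> Obj C; g \<in> carrier (Hom C y z)\<rbrakk> \<Longrightarrow>
        (\<lambda>f. Comp C x y z g f) \<in> linear_maps R (Hom C x y) (Hom C x z)"
    and Id_left:
      "\<lbrakk>x \<in> Obj C; y \<in> Obj C; f \<in> carrier (Hom C x y)\<rbrakk> \<Longrightarrow> Comp C x y y (Id C y) f = f"
    and Id_right:
      "\<lbrakk>x \<in> Obj C; y \<in> Obj C; f \<in> carrier (Hom C x y)\<rbrakk> \<Longrightarrow> Comp C x x y f (Id C x) = f"
    and Comp_assoc:
      "\<lbrakk>w \<in> Obj C; x \<in> Obj C; y \<in> Obj C; z \<in> Obj C;
        f \<in> carrier (Hom C w x); g \<in> carrier (Hom C x y); h \<in> carrier (Hom C y z)\<rbrakk> \<Longrightarrow>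
        Comp C w x z (Comp C x y z h g) f = Comp C w y z h (Comp C w x y g f)"

text \<open>\<open>fmor F x y\<close> is the action of \<open>F\<close> on the morphisms from \<open>x\<close> to \<open>y\<close>.\<close>

record ('o, 'm, 'p, 'n) kfun =
  fobj :: "'o \<Rightarrow> 'p"
  fmor :: "'o \<Rightarrow> 'o \<Rightarrow> 'm \<Rightarrow> 'n"

locale k_functor = source: k_category R C + target: k_category R B
  for R :: "('k, 'r) ring_scheme" (structure)
    and C :: "('o, 'k, 'm) kcat" and B :: "('p, 'k, 'n) kcat"
    and F :: "('o, 'm, 'p, 'n) kfun" +
  assumes fobj_closed: "x \<in> Obj C \<Longrightarrow> fobj F x \<in> Obj B"
    and fmor_linear:
      "\<lbrakk>x \<in> Obj C; y \<in> Obj C\<rbrakk> \<Longrightarrow>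
        fmor F x y \<in> linear_maps R (Hom C x y) (Hom B (fobj F x) (fobj F y))"
    and fmor_Id: "x \<in> Obj C \<Longrightarrow> fmor F x x (Id C x) = Id B (fobj F x)"
    and fmor_Comp:
      "\<lbrakk>x \<in> Obj C; y \<in> Obj C; z \<in> Obj C;
        f \<in> carrier (Hom C x y); g \<in> carrier (Hom C y z)\<rbrakk> \<Longrightarrow>
        fmor F x z (Comp C x y z g f) =
          Comp B (fobj F x) (fobj F y) (fobj F z) (fmor F y z g) (fmor F x y f)"

definition fully_faithful ::
  "('o, 'k, 'm) kcat \<Rightarrow> ('p, 'k, 'n) kcat \<Rightarrow> ('o, 'm, 'p, 'n) kfun \<Rightarrow> bool"
  where "fully_faithful C B F \<longleftrightarrow>
    (\<forall>x\<in>Obj C. \<forall>y\<in>Obj C.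
      bij_betw (fmor F x y) (carrier (Hom C x y)) (carrier (Hom B (fobj F x) (fobj F y))))"

section \<open>Coverings\<close>

definition star :: "('o, 'k, 'm) kcat \<Rightarrow> 'o \<Rightarrow> ('k, ('o \<Rightarrow> 'm) \<times> ('o \<Rightarrow> 'm)) module"
  where "star C b =
    module_prod (direct_sum (Obj C) (\<lambda>y. Hom C b y)) (direct_sum (Obj C) (\<lambda>y. Hom C y b))"

definition star_map ::
  "('o, 'k, 'm) kcat \<Rightarrow> ('p, 'k, 'n) kcat \<Rightarrow> ('o, 'm, 'p, 'n) kfun \<Rightarrow> 'o \<Rightarrow>
    ('o \<Rightarrow> 'm) \<times> ('o \<Rightarrow> 'm) \<Rightarrow> ('p \<Rightarrow> 'n) \<times> ('p \<Rightarrow> 'n)"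
  where "star_map C B F x =
    map_prod
      (direct_sum_map (Obj C) (\<lambda>y. Hom C x y) (Obj B) (\<lambda>z. Hom B (fobj F x) z)
        (fobj F) (\<lambda>y. fmor F x y))
      (direct_sum_map (Obj C) (\<lambda>y. Hom C y x) (Obj B) (\<lambda>z. Hom B z (fobj F x))
        (fobj F) (\<lambda>y. fmor F y x))"

definition covering ::
  "('k, 'r) ring_scheme \<Rightarrow> ('o, 'k, 'm) kcat \<Rightarrow> ('p, 'k, 'n) kcat \<Rightarrow> ('o, 'm, 'p, 'n) kfun \<Rightarrow> bool"
  where "covering R C B F \<longleftrightarrow>
    k_functor R C B F \<and>
    fobj F ` Obj C = Obj B \<and>
    (\<forall>b\<in>Obj B. \<forall>x\<in>Obj C. fobj F x = b \<longrightarrow>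
      star_map C B F x \<in> module_isos R (star C x) (star B b))"

section \<open>Fibre products\<close>

definition fibre_product ::
  "('o, 'k, 'm) kcat \<Rightarrow> ('q, 'k, 'l) kcat \<Rightarrow> ('o, 'm, 'p, 'n) kfun \<Rightarrow> ('q, 'l, 'p, 'n) kfun \<Rightarrow>
    ('o \<times> 'q, 'k, 'm \<times> 'l) kcat"
  where "fibre_product C D F G =
    \<lparr>Obj = {(x, y). x \<in> Obj C \<and> y \<in> Obj D \<and> fobj F x = fobj G y},
     Hom = (\<lambda>(x, y) (x', y').
       (module_prod (Hom C x x') (Hom D y y'))
         \<lparr>carrier := {(f, g). f \<in> carrier (Hom C x x') \<and> g \<in> carrier (Hom D y y') \<and>
            fmor F x x' f = fmor G y y' g}\<rparr>),
     Id = (\<lambda>(x, y). (Id C x, Id D y)),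
     Comp = (\<lambda>(x, y) (x', y') (x'', y'') (f', g') (f, g).
       (Comp C x x' x'' f' f, Comp D y y' y'' g' g))\<rparr>"

definition proj_right :: "('o \<times> 'q, 'm \<times> 'l, 'q, 'l) kfun"
  where "proj_right = \<lparr>fobj = snd, fmor = (\<lambda>_ _. snd)\<rparr>"

end

theory Submission
  imports Defs
begin

text \<open>
  A star map is a product of two maps between direct sums, one for outgoing and one for incoming
  morphisms. Such a map sorts the summands of its source by the fibres of the object map, so it is
  bijective exactly when, for every target object, the copairing of the maps out of the summands in
  the fibre is bijective (\<open>direct_sum_map_bij_iff\<close>). Thus \<open>F\<close> is a covering if and only if it is
  surjective on objects and for all \<open>x\<close> and \<open>b\<close> the induced map
  \<open>(\<Oplus>x' \<in> F\<inverse>(b). Hom C x x') \<rightarrow> Hom B (F x) b\<close> is bijective, and likewise for incoming morphisms.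

  In this form the claim is visible. Let \<open>(x, y)\<close> be an object of the fibre product and \<open>y'\<close> an object
  of \<open>D\<close>. The fibre of the projection over \<open>y'\<close> consists of the pairs \<open>(x', y')\<close> with
  \<open>x' \<in> F\<inverse>(G y')\<close>, and, since \<open>G\<close> is fully faithful, a morphism \<open>(x, y) \<rightarrow> (x', y')\<close> is
  determined by its first component, which may be any morphism \<open>x \<rightarrow> x'\<close>. Hence first components
  and \<open>G\<close> identify the induced map of the projection over \<open>y'\<close> with that of \<open>F\<close> over \<open>G y'\<close>
  (\<open>copairing_bij_transfer\<close>). Surjectivity on objects is immediate from that of \<open>F\<close>.
\<close>

section \<open>Linear maps and products of modules\<close>

lemma linear_mapsD:
  assumes "h \<in> linear_maps R M N"
  shows "u \<in> carrier M \<Longrightarrow> h u \<in> carrier N"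
    and "u \<in> carrier M \<Longrightarrow> v \<in> carrier M \<Longrightarrow> h (u \<oplus>\<^bsub>M\<^esub> v) = h u \<oplus>\<^bsub>N\<^esub> h v"
    and "a \<in> carrier R \<Longrightarrow> u \<in> carrier M \<Longrightarrow> h (a \<odot>\<^bsub>M\<^esub> u) = a \<odot>\<^bsub>N\<^esub> h u"
  using assms by (auto simp: linear_maps_def)

lemma linear_mapsI:
  assumes "\<And>u. u \<in> carrier M \<Longrightarrow> h u \<in> carrier N"
    and "\<And>u v. u \<in> carrier M \<Longrightarrow> v \<in> carrier M \<Longrightarrow> h (u \<oplus>\<^bsub>M\<^esub> v) = h u \<oplus>\<^bsub>N\<^esub> h v"
    and "\<And>a u. a \<in> carrier R \<Longrightarrow> u \<in> carrier M \<Longrightarrow> h (a \<odot>\<^bsub>M\<^esub> u) = a \<odot>\<^bsub>N\<^esub> h u"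
  shows "h \<in> linear_maps R M N"
  using assms by (auto simp: linear_maps_def)

lemma module_zero_closed: "module R M \<Longrightarrow> \<zero>\<^bsub>M\<^esub> \<in> carrier M"
  by (simp add: module_def abelian_groupE(2))

lemma linear_map_zero:
  assumes "h \<in> linear_maps R M N" "module R M" "module R N"
  shows "h \<zero>\<^bsub>M\<^esub> = \<zero>\<^bsub>N\<^esub>"
proof -
  interpret M: module R M by fact
  interpret N: module R N by fact
  have "h (\<zero>\<^bsub>R\<^esub> \<odot>\<^bsub>M\<^esub> \<zero>\<^bsub>M\<^esub>) = \<zero>\<^bsub>R\<^esub> \<odot>\<^bsub>N\<^esub> h \<zero>\<^bsub>M\<^esub>"
    by (rule linear_mapsD(3)[OF assms(1)]) simp_all
  thus ?thesis using linear_mapsD(1)[OF assms(1)] by simp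
qed

lemma linear_map_minus:
  assumes "h \<in> linear_maps R M N" "module R M" "module R N" "u \<in> carrier M"
  shows "h (\<ominus>\<^bsub>M\<^esub> u) = \<ominus>\<^bsub>N\<^esub> h u"
proof -
  interpret M: module R M by fact
  interpret N: module R N by fact
  have "h (\<ominus>\<^bsub>M\<^esub> u) \<oplus>\<^bsub>N\<^esub> h u = h \<zero>\<^bsub>M\<^esub>"
    using linear_mapsD(2)[OF assms(1), of "\<ominus>\<^bsub>M\<^esub> u" u] assms(4) by (simp add: M.M.l_neg)
  thus ?thesis
    using linear_map_zero[OF assms(1-3)] linear_mapsD(1)[OF assms(1)] assms(4)
    by (simp add: N.M.minus_equality)
qed

lemma linear_map_finsum:
  assumes "h \<in> linear_maps R M N" "module R M" "module R N"
    and "finite A" "f \<in> A \<rightarrow> carrier M"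
  shows "h (finsum M f A) = finsum N (\<lambda>i. h (f i)) A"
proof -
  interpret M: module R M by fact
  interpret N: module R N by fact
  show ?thesis using assms(4,5)
  proof (induction A rule: finite_induct)
    case empty
    thus ?case by (simp add: linear_map_zero[OF assms(1-3)])
  next
    case (insert i A)
    hence "f i \<in> carrier M" "f \<in> A \<rightarrow> carrier M" by auto
    moreover have "(\<lambda>i. h (f i)) \<in> A \<rightarrow> carrier N" "h (f i) \<in> carrier N"
      using calculation linear_mapsD(1)[OF assms(1)] by auto
    ultimately show ?case
      using insert linear_mapsD(2)[OF assms(1)] by (simp add: M.M.finsum_closed)
  qed
qed

lemma module_prod_simps [simp]:
  "carrier (module_prod M N) = carrier M \<times> carrier N"
  "\<zero>\<^bsub>module_prod M N\<^esub> = (\<zero>\<^bsub>M\<^esub>, \<zero>\<^bsub>N\<^esub>)"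
  "(u, v) \<oplus>\<^bsub>module_prod M N\<^esub> (u', v') = (u \<oplus>\<^bsub>M\<^esub> u', v \<oplus>\<^bsub>N\<^esub> v')"
  "a \<odot>\<^bsub>module_prod M N\<^esub> (u, v) = (a \<odot>\<^bsub>M\<^esub> u, a \<odot>\<^bsub>N\<^esub> v)"
  by (simp_all add: module_prod_def)

lemma module_module_prod:
  assumes "module R M" "module R N"
  shows "module R (module_prod M N)"
proof -
  interpret M: module R M by fact
  interpret N: module R N by fact
  have "abelian_group (module_prod M N)"
  proof (rule abelian_groupI)
    fix w assume "w \<in> carrier (module_prod M N)"
    then obtain u v where "w = (u, v)" "u \<in> carrier M" "v \<in> carrier N" by auto
    thus "\<exists>w'\<in>carrier (module_prod M N). w' \<oplus>\<^bsub>module_prod M N\<^esub> w = \<zero>\<^bsub>module_prod M N\<^esub>"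
      by (intro bexI[of _ "(\<ominus>\<^bsub>M\<^esub> u, \<ominus>\<^bsub>N\<^esub> v)"]) (auto simp: M.M.l_neg N.M.l_neg)
  qed (auto simp: M.M.a_assoc N.M.a_assoc intro: M.M.a_comm N.M.a_comm)
  thus ?thesis
    by (intro moduleI M.R.is_cring)
      (auto simp: M.smult_l_distr N.smult_l_distr M.smult_r_distr N.smult_r_distr
        M.smult_assoc1 N.smult_assoc1)
qed

lemma module_prod_neg:
  assumes "module R M" "module R N" "u \<in> carrier M" "v \<in> carrier N"
  shows "\<ominus>\<^bsub>module_prod M N\<^esub> (u, v) = (\<ominus>\<^bsub>M\<^esub> u, \<ominus>\<^bsub>N\<^esub> v)"
proof -
  interpret M: module R M by fact
  interpret N: module R N by fact
  interpret P: module R "module_prod M N" by (rule module_module_prod) fact+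
  show ?thesis
    by (rule P.M.minus_equality) (use assms in \<open>auto simp: M.M.l_neg N.M.l_neg\<close>)
qed

text \<open>
  The morphism modules of a fibre product are of this form: pairs on which two linear maps into a
  common module agree are closed under the operations of the product.
\<close>

lemma module_equalizer:
  assumes "module R M" "module R N" "module R L"
    and f: "f \<in> linear_maps R M L" and g: "g \<in> linear_maps R N L"
  shows "module R ((module_prod M N)
    \<lparr>carrier := {(u, v). u \<in> carrier M \<and> v \<in> carrier N \<and> f u = g v}\<rparr>)"
    (is "module R (_\<lparr>carrier := ?H\<rparr>)")
proof -
  interpret M: module R M by fact
  interpret N: module R N by fact
  interpret P: module R "module_prod M N" by (rule module_module_prod) fact+
  have "submodule ?H R (module_prod M N)"
  proof (rule P.submoduleI)
    show "\<zero>\<^bsub>module_prod M N\<^esub> \<in> ?H"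
      using linear_map_zero[OF f] linear_map_zero[OF g] assms by simp
  next
    fix w assume "w \<in> ?H"
    thus "\<ominus>\<^bsub>module_prod M N\<^esub> w \<in> ?H"
      using linear_map_minus[OF f] linear_map_minus[OF g] assms(1-3)
      by (auto simp: module_prod_neg[OF assms(1,2)])
  qed (auto simp: linear_mapsD(2,3)[OF f] linear_mapsD(2,3)[OF g])
  thus ?thesis by (rule submodule.submodule_is_module) (rule P.module_axioms)
qed

lemma map_prod_bij_betw_iff:
  assumes "A \<noteq> {}" "B \<noteq> {}"
  shows "bij_betw (map_prod f g) (A \<times> B) (A' \<times> B') \<longleftrightarrow> bij_betw f A A' \<and> bij_betw g B B'"
proof -
  have "map_prod f g ` (A \<times> B) = f ` A \<times> g ` B" by (rule map_prod_surj_on) auto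
  moreover have "inj_on (map_prod f g) (A \<times> B) \<longleftrightarrow> inj_on f A \<and> inj_on g B"
    using assms by (fastforce simp: inj_on_def)
  ultimately show ?thesis using assms by (auto simp: bij_betw_def times_eq_iff)
qed

lemma map_prod_linear:
  assumes "f \<in> linear_maps R M M'" "g \<in> linear_maps R N N'"
  shows "map_prod f g \<in> linear_maps R (module_prod M N) (module_prod M' N')"
  by (rule linear_mapsI) (auto simp: linear_mapsD[OF assms(1)] linear_mapsD[OF assms(2)])

section \<open>Maps out of direct sums\<close>

text \<open>
  The map \<open>(\<Oplus>i\<in>I. M i) \<rightarrow> N\<close> whose component on the summand \<open>M i\<close> is \<open>h i\<close>.
\<close>

definition copairing ::
  "'i set \<Rightarrow> ('i \<Rightarrow> ('k, 'm, 'x) module_scheme) \<Rightarrow> ('k, 'n, 'y) module_scheme \<Rightarrow>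
    ('i \<Rightarrow> 'm \<Rightarrow> 'n) \<Rightarrow> ('i \<Rightarrow> 'm) \<Rightarrow> 'n"
  where "copairing I M N h u = finsum N (\<lambda>i. h i (u i)) {i \<in> I. u i \<noteq> \<zero>\<^bsub>M i\<^esub>}"

lemma direct_sum_map_apply:
  "j \<in> J \<Longrightarrow> direct_sum_map I M J N r h u j = copairing {i \<in> I. r i = j} M (N j) h u"
  by (simp add: direct_sum_map_def copairing_def conj_assoc)

lemma copairing_cong_carrier:
  assumes "\<And>i. i \<in> I \<Longrightarrow> u i = v i"
    and "\<And>i. i \<in> I \<Longrightarrow> h i (u i) \<in> carrier N" "module R N"
  shows "copairing I M N h u = copairing I M N h v"
proof -
  interpret N: module R N by fact
  have "{i \<in> I. u i \<noteq> \<zero>\<^bsub>M i\<^esub>} = {i \<in> I. v i \<noteq> \<zero>\<^bsub>M i\<^esub>}" using assms(1) by auto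
  thus ?thesis
    unfolding copairing_def by (intro N.M.finsum_cong') (use assms in auto)
qed

lemma direct_sum_carrier:
  "u \<in> carrier (direct_sum I M) \<longleftrightarrow>
    u \<in> (\<Pi>\<^sub>E i\<in>I. carrier (M i)) \<and> finite {i \<in> I. u i \<noteq> \<zero>\<^bsub>M i\<^esub>}"
  by (simp add: direct_sum_def)

lemma direct_sum_ops:
  "u \<oplus>\<^bsub>direct_sum I M\<^esub> v = (\<lambda>i\<in>I. u i \<oplus>\<^bsub>M i\<^esub> v i)"
  "a \<odot>\<^bsub>direct_sum I M\<^esub> u = (\<lambda>i\<in>I. a \<odot>\<^bsub>M i\<^esub> u i)"
  by (simp_all add: direct_sum_def)

lemma direct_sum_nonempty:
  assumes "\<And>i. i \<in> I \<Longrightarrow> \<zero>\<^bsub>M i\<^esub> \<in> carrier (M i)"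
  shows "carrier (direct_sum I M) \<noteq> {}"
proof -
  have "(\<lambda>i\<in>I. \<zero>\<^bsub>M i\<^esub>) \<in> carrier (direct_sum I M)"
    using assms by (auto simp: direct_sum_carrier)
  thus ?thesis by blast
qed

lemma restrict_direct_sum:
  assumes "u \<in> carrier (direct_sum I M)" "K \<subseteq> I"
  shows "restrict u K \<in> carrier (direct_sum K M)"
proof -
  have "finite {i \<in> K. restrict u K i \<noteq> \<zero>\<^bsub>M i\<^esub>}"
    by (rule finite_subset[of _ "{i \<in> I. u i \<noteq> \<zero>\<^bsub>M i\<^esub>}"])
      (use assms in \<open>auto simp: direct_sum_carrier\<close>)
  moreover have "restrict u K \<in> (\<Pi>\<^sub>E i\<in>K. carrier (M i))"
    using assms by (auto simp: direct_sum_carrier)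
  ultimately show ?thesis unfolding direct_sum_carrier by blast
qed

lemma extend_direct_sum:
  assumes "u \<in> carrier (direct_sum K M)" "K \<subseteq> I"
    and "\<And>i. i \<in> I \<Longrightarrow> \<zero>\<^bsub>M i\<^esub> \<in> carrier (M i)"
  shows "(\<lambda>i\<in>I. if i \<in> K then u i else \<zero>\<^bsub>M i\<^esub>) \<in> carrier (direct_sum I M)"
proof -
  let ?v = "\<lambda>i\<in>I. if i \<in> K then u i else \<zero>\<^bsub>M i\<^esub>"
  have "finite {i \<in> I. ?v i \<noteq> \<zero>\<^bsub>M i\<^esub>}"
    by (rule finite_subset[of _ "{i \<in> K. u i \<noteq> \<zero>\<^bsub>M i\<^esub>}"])
      (use assms in \<open>auto simp: direct_sum_carrier\<close>)
  moreover have "?v \<in> (\<Pi>\<^sub>E i\<in>I. carrier (M i))"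
    using assms by (auto simp: direct_sum_carrier)
  ultimately show ?thesis unfolding direct_sum_carrier by blast
qed

text \<open>
  Supports of different families differ, so sums over them can only be compared after enlarging
  both to a common finite index set.
\<close>

lemma copairing_superset:
  assumes "\<And>i. i \<in> I \<Longrightarrow> module R (M i)" "module R N"
    and h: "\<And>i. i \<in> I \<Longrightarrow> h i \<in> linear_maps R (M i) N"
    and u: "\<And>i. i \<in> I \<Longrightarrow> u i \<in> carrier (M i)"
    and S: "finite S" "S \<subseteq> I" "{i \<in> I. u i \<noteq> \<zero>\<^bsub>M i\<^esub>} \<subseteq> S"
  shows "copairing I M N h u = finsum N (\<lambda>i. h i (u i)) S"
proof -
  interpret N: module R N by fact
  have "h i (u i) = \<zero>\<^bsub>N\<^esub>" if "i \<in> S - {i \<in> I. u i \<noteq> \<zero>\<^bsub>M i\<^esub>}" for i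
    using that S linear_map_zero[OF h assms(1,2), of i] by auto
  thus ?thesis unfolding copairing_def
    by (intro N.M.add.finprod_mono_neutral_cong_left)
      (use S linear_mapsD(1)[OF h u] in auto)
qed

lemma copairing_closed:
  assumes "module R N"
    and "\<And>i. i \<in> I \<Longrightarrow> h i \<in> carrier (M i) \<rightarrow> carrier N"
    and "\<And>i. i \<in> I \<Longrightarrow> u i \<in> carrier (M i)"
  shows "copairing I M N h u \<in> carrier N"
proof -
  interpret N: module R N by fact
  show ?thesis unfolding copairing_def by (rule N.M.finsum_closed) (use assms in auto)
qed

lemma copairing_add:
  assumes "\<And>i. i \<in> I \<Longrightarrow> module R (M i)" "module R N"
    and h: "\<And>i. i \<in> I \<Longrightarrow> h i \<in> linear_maps R (M i) N"
    and u: "\<And>i. i \<in> I \<Longrightarrow> u i \<in> carrier (M i)" "finite {i \<in> I. u i \<noteq> \<zero>\<^bsub>M i\<^esub>}"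
    and v: "\<And>i. i \<in> I \<Longrightarrow> v i \<in> carrier (M i)" "finite {i \<in> I. v i \<noteq> \<zero>\<^bsub>M i\<^esub>}"
    and w: "\<And>i. i \<in> I \<Longrightarrow> w i = u i \<oplus>\<^bsub>M i\<^esub> v i"
  shows "copairing I M N h w = copairing I M N h u \<oplus>\<^bsub>N\<^esub> copairing I M N h v"
proof -
  interpret N: module R N by fact
  define S where "S = {i \<in> I. u i \<noteq> \<zero>\<^bsub>M i\<^esub>} \<union> {i \<in> I. v i \<noteq> \<zero>\<^bsub>M i\<^esub>}"
  have S: "finite S" "S \<subseteq> I" using u v by (auto simp: S_def)
  note superset = copairing_superset[OF assms(1,2) h _ S]
  have "w i \<in> carrier (M i)" "u i = \<zero>\<^bsub>M i\<^esub> \<Longrightarrow> v i = \<zero>\<^bsub>M i\<^esub> \<Longrightarrow> w i = \<zero>\<^bsub>M i\<^esub>"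
    if "i \<in> I" for i
  proof -
    interpret module R "M i" by (rule assms(1)[OF that])
    show "w i \<in> carrier (M i)" using u v w that by simp
    show "w i = \<zero>\<^bsub>M i\<^esub>" if "u i = \<zero>\<^bsub>M i\<^esub>" "v i = \<zero>\<^bsub>M i\<^esub>" using that w \<open>i \<in> I\<close> by simp
  qed
  hence "copairing I M N h w = finsum N (\<lambda>i. h i (w i)) S"
    by (intro superset) (auto simp: S_def)
  also have "\<dots> = finsum N (\<lambda>i. h i (u i) \<oplus>\<^bsub>N\<^esub> h i (v i)) S"
    by (rule N.M.finsum_cong')
      (use S w linear_mapsD(1,2)[OF h] u(1) v(1) in \<open>auto simp: subset_iff\<close>)
  also have "\<dots> = finsum N (\<lambda>i. h i (u i)) S \<oplus>\<^bsub>N\<^esub> finsum N (\<lambda>i. h i (v i)) S"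
    by (rule N.M.finsum_addf) (use S linear_mapsD(1)[OF h] u v in auto)
  also have "finsum N (\<lambda>i. h i (u i)) S = copairing I M N h u"
    by (rule superset[symmetric]) (use u in \<open>auto simp: S_def\<close>)
  also have "finsum N (\<lambda>i. h i (v i)) S = copairing I M N h v"
    by (rule superset[symmetric]) (use v in \<open>auto simp: S_def\<close>)
  finally show ?thesis .
qed

lemma copairing_smult:
  assumes "\<And>i. i \<in> I \<Longrightarrow> module R (M i)" "module R N"
    and h: "\<And>i. i \<in> I \<Longrightarrow> h i \<in> linear_maps R (M i) N"
    and u: "\<And>i. i \<in> I \<Longrightarrow> u i \<in> carrier (M i)" "finite {i \<in> I. u i \<noteq> \<zero>\<^bsub>M i\<^esub>}"
    and a: "a \<in> carrier R"
    and w: "\<And>i. i \<in> I \<Longrightarrow> w i = a \<odot>\<^bsub>M i\<^esub> u i"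
  shows "copairing I M N h w = a \<odot>\<^bsub>N\<^esub> copairing I M N h u"
proof -
  interpret N: module R N by fact
  define S where "S = {i \<in> I. u i \<noteq> \<zero>\<^bsub>M i\<^esub>}"
  have S: "finite S" "S \<subseteq> I" using u by (auto simp: S_def)
  have "w i \<in> carrier (M i)" "u i = \<zero>\<^bsub>M i\<^esub> \<Longrightarrow> w i = \<zero>\<^bsub>M i\<^esub>" if "i \<in> I" for i
  proof -
    interpret module R "M i" by (rule assms(1)[OF that])
    show "w i \<in> carrier (M i)" using u w a that by simp
    show "w i = \<zero>\<^bsub>M i\<^esub>" if "u i = \<zero>\<^bsub>M i\<^esub>" using that w a \<open>i \<in> I\<close> by simp
  qed
  hence "copairing I M N h w = finsum N (\<lambda>i. h i (w i)) S"
    by (intro copairing_superset[OF assms(1,2) h _ S]) (auto simp: S_def)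
  also have "\<dots> = finsum N (\<lambda>i. a \<odot>\<^bsub>N\<^esub> h i (u i)) S"
    by (rule N.M.finsum_cong')
      (use S w a linear_mapsD(1,3)[OF h] u(1) in \<open>auto simp: subset_iff\<close>)
  also have "\<dots> = a \<odot>\<^bsub>N\<^esub> finsum N (\<lambda>i. h i (u i)) S"
    by (rule N.finsum_smult_ldistr[symmetric]) (use S a linear_mapsD(1)[OF h] u in auto)
  finally show ?thesis by (simp add: copairing_def S_def)
qed

lemma direct_sum_map_linear:
  assumes M: "\<And>i. i \<in> I \<Longrightarrow> module R (M i)" and N: "\<And>j. j \<in> J \<Longrightarrow> module R (N j)"
    and r: "r \<in> I \<rightarrow> J"
    and h: "\<And>i. i \<in> I \<Longrightarrow> h i \<in> linear_maps R (M i) (N (r i))"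
  shows "direct_sum_map I M J N r h \<in> linear_maps R (direct_sum I M) (direct_sum J N)"
proof (rule linear_mapsI)
  have fin: "finite {i \<in> {i \<in> I. r i = j}. u i \<noteq> \<zero>\<^bsub>M i\<^esub>}"
    if "u \<in> carrier (direct_sum I M)" for u j
    by (rule finite_subset[of _ "{i \<in> I. u i \<noteq> \<zero>\<^bsub>M i\<^esub>}"])
      (use that in \<open>auto simp: direct_sum_carrier\<close>)
  {
    fix u assume u: "u \<in> carrier (direct_sum I M)"
    let ?f = "direct_sum_map I M J N r h u"
    have "?f j \<in> carrier (N j)" if "j \<in> J" for j
      unfolding direct_sum_map_apply[OF that]
      by (rule copairing_closed[OF N[OF that]])
        (use u linear_mapsD(1)[OF h] in \<open>auto simp: direct_sum_carrier\<close>)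
    moreover have "{j \<in> J. ?f j \<noteq> \<zero>\<^bsub>N j\<^esub>} \<subseteq> r ` {i \<in> I. u i \<noteq> \<zero>\<^bsub>M i\<^esub>}"
    proof
      fix j assume j: "j \<in> {j \<in> J. ?f j \<noteq> \<zero>\<^bsub>N j\<^esub>}"
      then interpret module R "N j" using N by simp
      have "{i \<in> {i \<in> I. r i = j}. u i \<noteq> \<zero>\<^bsub>M i\<^esub>} \<noteq> {}"
        using j by (auto simp: direct_sum_map_def finsum_empty simp del: Collect_empty_eq)
      thus "j \<in> r ` {i \<in> I. u i \<noteq> \<zero>\<^bsub>M i\<^esub>}" by blast
    qed
    moreover have "finite (r ` {i \<in> I. u i \<noteq> \<zero>\<^bsub>M i\<^esub>})" using u by (simp add: direct_sum_carrier)
    moreover have "?f \<in> extensional J" by (simp add: direct_sum_map_def)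
    ultimately show "?f \<in> carrier (direct_sum J N)"
      unfolding direct_sum_carrier PiE_def by (blast intro: finite_subset)
  }
  {
    fix u v assume u: "u \<in> carrier (direct_sum I M)" and v: "v \<in> carrier (direct_sum I M)"
    show "direct_sum_map I M J N r h (u \<oplus>\<^bsub>direct_sum I M\<^esub> v) =
      direct_sum_map I M J N r h u \<oplus>\<^bsub>direct_sum J N\<^esub> direct_sum_map I M J N r h v" (is "?l = ?r")
    proof (rule extensionalityI[of _ J])
      fix j assume j: "j \<in> J"
      show "?l j = ?r j"
        using j unfolding direct_sum_ops restrict_apply direct_sum_map_apply[OF j] if_P
        by (simp, intro copairing_add[OF M N[OF j] _ _ fin[OF u] _ fin[OF v]])
          (use h u v in \<open>auto simp: direct_sum_carrier\<close>)
    qed (auto simp: direct_sum_map_def direct_sum_ops)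
  }
  {
    fix a u assume a: "a \<in> carrier R" and u: "u \<in> carrier (direct_sum I M)"
    show "direct_sum_map I M J N r h (a \<odot>\<^bsub>direct_sum I M\<^esub> u) =
      a \<odot>\<^bsub>direct_sum J N\<^esub> direct_sum_map I M J N r h u" (is "?l = ?r")
    proof (rule extensionalityI[of _ J])
      fix j assume j: "j \<in> J"
      show "?l j = ?r j"
        using j unfolding direct_sum_ops restrict_apply direct_sum_map_apply[OF j] if_P
        by (simp, intro copairing_smult[OF M N[OF j] _ _ fin[OF u] a])
          (use h u in \<open>auto simp: direct_sum_carrier\<close>)
    qed (auto simp: direct_sum_map_def direct_sum_ops)
  }
qed

text \<open>
  The map respects the decompositions of both sides indexed by \<open>J\<close>, so it is bijective if and only
  if each of its components is. For the forward direction a family on one fibre is extended by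
  zero; for the converse, preimages of the components are glued along the fibres.
\<close>

lemma direct_sum_map_bij_iff:
  assumes M: "\<And>i. i \<in> I \<Longrightarrow> module R (M i)" and N: "\<And>j. j \<in> J \<Longrightarrow> module R (N j)"
    and r: "r \<in> I \<rightarrow> J"
    and h: "\<And>i. i \<in> I \<Longrightarrow> h i \<in> linear_maps R (M i) (N (r i))"
  shows "bij_betw (direct_sum_map I M J N r h) (carrier (direct_sum I M)) (carrier (direct_sum J N))
    \<longleftrightarrow> (\<forall>j\<in>J. bij_betw (copairing {i \<in> I. r i = j} M (N j) h)
          (carrier (direct_sum {i \<in> I. r i = j} M)) (carrier (N j)))"
    (is "bij_betw ?T _ _ \<longleftrightarrow> (\<forall>j\<in>J. bij_betw (?S j) (carrier (direct_sum (?I j) M)) _)")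
proof
  have zero: "\<zero>\<^bsub>M i\<^esub> \<in> carrier (M i)" if "i \<in> I" for i
    using M[OF that] by (rule module_zero_closed)
  have h_closed: "h i (u i) \<in> carrier (N j)"
    if "u \<in> carrier (direct_sum (?I j) M)" "i \<in> ?I j" for u i j
    using that linear_mapsD(1)[OF h] by (auto simp: direct_sum_carrier)
  have restrict_fibre: "?S j (restrict u (?I j)) = ?T u j"
    if "u \<in> carrier (direct_sum I M)" "j \<in> J" for u j
  proof -
    have "restrict u (?I j) \<in> carrier (direct_sum (?I j) M)"
      using that by (intro restrict_direct_sum) auto
    thus ?thesis
      unfolding direct_sum_map_apply[OF that(2)]
      by - (rule copairing_cong_carrier[OF _ _ N[OF that(2)]], simp, rule h_closed)
  qed
  {
    assume T: "bij_betw ?T (carrier (direct_sum I M)) (carrier (direct_sum J N))"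
    show "\<forall>j\<in>J. bij_betw (?S j) (carrier (direct_sum (?I j) M)) (carrier (N j))"
    proof
      fix j assume j: "j \<in> J"
      define ext where "ext u = (\<lambda>i\<in>I. if i \<in> ?I j then u i else \<zero>\<^bsub>M i\<^esub>)" for u
      have ext: "ext u \<in> carrier (direct_sum I M)"
        if "u \<in> carrier (direct_sum (?I j) M)" for u
        unfolding ext_def using that by (intro extend_direct_sum zero) auto
      have restrict_ext: "restrict (ext u) (?I j) = u"
        if "u \<in> carrier (direct_sum (?I j) M)" for u
        using that by (auto simp: ext_def direct_sum_carrier fun_eq_iff PiE_def extensional_def)
      have T_ext: "?T (ext u) = (\<lambda>k\<in>J. if k = j then ?S j u else \<zero>\<^bsub>N k\<^esub>)"
        if u: "u \<in> carrier (direct_sum (?I j) M)" for u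
      proof (rule extensionalityI[of _ J])
        fix k assume k: "k \<in> J"
        show "?T (ext u) k = (\<lambda>k\<in>J. if k = j then ?S j u else \<zero>\<^bsub>N k\<^esub>) k"
        proof (cases "k = j")
          case True
          thus ?thesis
            using k restrict_fibre[OF ext[OF u] j] restrict_ext[OF u] by simp
        next
          case False
          interpret module R "N k" by (rule N[OF k])
          have "{i \<in> ?I k. ext u i \<noteq> \<zero>\<^bsub>M i\<^esub>} = {}" using False by (auto simp: ext_def)
          hence "?S k (ext u) = \<zero>\<^bsub>N k\<^esub>" unfolding copairing_def by (simp only: finsum_empty)
          thus ?thesis using False k by (simp add: direct_sum_map_apply)
        qed
      qed (auto simp: direct_sum_map_def)
      show "bij_betw (?S j) (carrier (direct_sum (?I j) M)) (carrier (N j))"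
      proof (rule bij_betw_imageI)
        show "inj_on (?S j) (carrier (direct_sum (?I j) M))"
        proof (rule inj_onI)
          fix u v
          assume uv: "u \<in> carrier (direct_sum (?I j) M)" "v \<in> carrier (direct_sum (?I j) M)"
            and "?S j u = ?S j v"
          hence "?T (ext u) = ?T (ext v)" by (simp only: T_ext)
          hence "ext u = ext v"
            by (rule inj_onD[OF bij_betw_imp_inj_on[OF T]]) (intro ext uv)+
          hence "restrict (ext u) (?I j) = restrict (ext v) (?I j)" by (rule arg_cong)
          thus "u = v" unfolding restrict_ext[OF uv(1)] restrict_ext[OF uv(2)] .
        qed
        show "?S j ` carrier (direct_sum (?I j) M) = carrier (N j)"
        proof (intro equalityI subsetI)
          fix w assume "w \<in> ?S j ` carrier (direct_sum (?I j) M)"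
          then obtain u where "u \<in> carrier (direct_sum (?I j) M)" "w = ?S j u" by blast
          thus "w \<in> carrier (N j)"
            using linear_mapsD(1)[OF h]
            by (auto intro!: copairing_closed[OF N[OF j]] simp: direct_sum_carrier)
        next
          fix w assume w: "w \<in> carrier (N j)"
          define W where "W = (\<lambda>k\<in>J. if k = j then w else \<zero>\<^bsub>N k\<^esub>)"
          have "{k \<in> J. W k \<noteq> \<zero>\<^bsub>N k\<^esub>} \<subseteq> {j}" by (auto simp: W_def)
          hence "W \<in> carrier (direct_sum J N)"
            using w module_zero_closed[OF N]
            by (auto simp: W_def direct_sum_carrier intro: finite_subset)
          hence "W \<in> ?T ` carrier (direct_sum I M)" by (simp only: bij_betw_imp_surj_on[OF T])
          then obtain u where u: "u \<in> carrier (direct_sum I M)" "?T u = W" by (metis imageE)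
          hence "?S j (restrict u (?I j)) = w"
            using restrict_fibre[OF u(1) j] j by (simp add: W_def)
          moreover have "restrict u (?I j) \<in> carrier (direct_sum (?I j) M)"
            using u(1) by (intro restrict_direct_sum) auto
          ultimately show "w \<in> ?S j ` carrier (direct_sum (?I j) M)" by blast
        qed
      qed
    qed
  }
  {
    assume S: "\<forall>j\<in>J. bij_betw (?S j) (carrier (direct_sum (?I j) M)) (carrier (N j))"
    show "bij_betw ?T (carrier (direct_sum I M)) (carrier (direct_sum J N))"
    proof (rule bij_betw_imageI)
      show "inj_on ?T (carrier (direct_sum I M))"
      proof (rule inj_onI)
        fix u v
        assume u: "u \<in> carrier (direct_sum I M)" and v: "v \<in> carrier (direct_sum I M)"
          and eq: "?T u = ?T v"
        show "u = v"
        proof (rule extensionalityI[of _ I])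
          fix i assume i: "i \<in> I"
          let ?j = "r i"
          have j: "?j \<in> J" using i r by auto
          have "restrict u (?I ?j) \<in> carrier (direct_sum (?I ?j) M)"
            "restrict v (?I ?j) \<in> carrier (direct_sum (?I ?j) M)"
            using u v by (intro restrict_direct_sum; auto)+
          moreover have "?S ?j (restrict u (?I ?j)) = ?S ?j (restrict v (?I ?j))"
            using restrict_fibre[OF u j] restrict_fibre[OF v j] eq by simp
          ultimately have "restrict u (?I ?j) = restrict v (?I ?j)"
            using S j by (auto simp: bij_betw_def dest: inj_onD)
          thus "u i = v i" using i by (auto simp: fun_eq_iff restrict_def split: if_splits)
        qed (use u v in \<open>auto simp: direct_sum_carrier PiE_def\<close>)
      qed
      have T_closed: "?T u \<in> carrier (direct_sum J N)" if "u \<in> carrier (direct_sum I M)" for u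
        using linear_mapsD(1)[OF direct_sum_map_linear] assms that by metis
      show "?T ` carrier (direct_sum I M) = carrier (direct_sum J N)"
      proof (intro equalityI subsetI)
        fix w assume w: "w \<in> carrier (direct_sum J N)"
        define p where "p j = inv_into (carrier (direct_sum (?I j) M)) (?S j) (w j)" for j
        have p: "p j \<in> carrier (direct_sum (?I j) M)" "?S j (p j) = w j" if "j \<in> J" for j
        proof -
          have "w j \<in> ?S j ` carrier (direct_sum (?I j) M)"
            using S w that by (auto simp: bij_betw_def direct_sum_carrier)
          thus "p j \<in> carrier (direct_sum (?I j) M)" "?S j (p j) = w j"
            unfolding p_def by (rule inv_into_into, rule f_inv_into_f)
        qed
        define u where "u = (\<lambda>i\<in>I. p (r i) i)"
        \<comment> \<open>Injectivity makes the preimage of zero vanish, so only the finitely many fibres over the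
          support of \<open>w\<close> contribute to the support of \<open>u\<close>.\<close>
        have p_zero: "p (r i) i = \<zero>\<^bsub>M i\<^esub>" if i: "i \<in> I" "w (r i) = \<zero>\<^bsub>N (r i)\<^esub>" for i
        proof -
          let ?j = "r i" and ?z = "\<lambda>i\<in>?I (r i). \<zero>\<^bsub>M i\<^esub>"
          have j: "?j \<in> J" using i r by auto
          interpret module R "N ?j" by (rule N[OF j])
          have supp: "{i' \<in> ?I ?j. ?z i' \<noteq> \<zero>\<^bsub>M i'\<^esub>} = {}" by auto
          hence "finite {i' \<in> ?I ?j. ?z i' \<noteq> \<zero>\<^bsub>M i'\<^esub>}" by (simp only: finite.emptyI)
          moreover have "?z \<in> (\<Pi>\<^sub>E i\<in>?I ?j. carrier (M i))" using zero by auto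
          ultimately have z: "?z \<in> carrier (direct_sum (?I ?j) M)"
            unfolding direct_sum_carrier by blast
          from supp have "?S ?j ?z = \<zero>\<^bsub>N ?j\<^esub>" unfolding copairing_def by (simp only: finsum_empty)
          hence "?S ?j (p ?j) = ?S ?j ?z" using p(2)[OF j] i by simp
          hence "p ?j = ?z" using S j p(1)[OF j] z by (auto simp: bij_betw_def dest: inj_onD)
          thus ?thesis using i by simp
        qed
        have "{i \<in> I. u i \<noteq> \<zero>\<^bsub>M i\<^esub>} \<subseteq>
          (\<Union>j\<in>{j \<in> J. w j \<noteq> \<zero>\<^bsub>N j\<^esub>}. {i \<in> ?I j. p j i \<noteq> \<zero>\<^bsub>M i\<^esub>})"
          using p_zero r by (auto simp: u_def)
        moreover have "finite \<dots>"
          using w p(1) by (intro finite_UN_I) (auto simp: direct_sum_carrier)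
        ultimately have "finite {i \<in> I. u i \<noteq> \<zero>\<^bsub>M i\<^esub>}" by (rule finite_subset)
        moreover have "p (r i) i \<in> carrier (M i)" if "i \<in> I" for i
          using p(1)[of "r i"] that r by (auto simp: direct_sum_carrier)
        ultimately have u: "u \<in> carrier (direct_sum I M)"
          by (auto simp: direct_sum_carrier u_def)
        have "?T u = w"
        proof (rule extensionalityI[of _ J])
          fix j assume j: "j \<in> J"
          have "restrict u (?I j) = p j"
            using p(1)[OF j]
            by (auto simp: u_def direct_sum_carrier fun_eq_iff PiE_def extensional_def)
          thus "?T u j = w j" using restrict_fibre[OF u j] p(2)[OF j] by simp
        qed (use w in \<open>auto simp: direct_sum_map_def direct_sum_carrier PiE_def\<close>)
        thus "w \<in> ?T ` carrier (direct_sum I M)" using u by blast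
      qed (use T_closed in auto)
    qed
  }
qed

text \<open>
  Bijectivity of a copairing is invariant under reindexing along \<open>q\<close> combined with isomorphisms
  \<open>\<phi> i\<close> of the summands and \<open>\<psi>\<close> of the targets: the induced bijection of direct sums fits into
  a commutative square with \<open>\<psi>\<close> and the two copairings.
\<close>

lemma copairing_bij_transfer:
  assumes S: "bij_betw (copairing I M N h) (carrier (direct_sum I M)) (carrier N)"
    and q: "bij_betw q I I'"
    and M: "\<And>i. i \<in> I \<Longrightarrow> module R (M i)" and M': "\<And>i. i \<in> I' \<Longrightarrow> module R (M' i)"
    and N: "module R N" and N': "module R N'"
    and \<phi>: "\<And>i. i \<in> I \<Longrightarrow> \<phi> i \<in> module_isos R (M' (q i)) (M i)"
    and \<psi>: "\<psi> \<in> module_isos R N' N"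
    and h': "\<And>i. i \<in> I' \<Longrightarrow> h' i \<in> carrier (M' i) \<rightarrow> carrier N'"
    and square: "\<And>i m. i \<in> I \<Longrightarrow> m \<in> carrier (M' (q i)) \<Longrightarrow> \<psi> (h' (q i) m) = h i (\<phi> i m)"
  shows "bij_betw (copairing I' M' N' h') (carrier (direct_sum I' M')) (carrier N')"
proof -
  interpret N: module R N by fact
  interpret N': module R N' by fact
  have q_in: "q i \<in> I'" if "i \<in> I" for i using q that by (auto simp: bij_betw_def)
  have \<phi>_bij: "bij_betw (\<phi> i) (carrier (M' (q i))) (carrier (M i))" if "i \<in> I" for i
    using \<phi>[OF that] by (simp add: module_isos_def)
  have \<phi>_zero: "\<phi> i m = \<zero>\<^bsub>M i\<^esub> \<longleftrightarrow> m = \<zero>\<^bsub>M' (q i)\<^esub>" if "i \<in> I" "m \<in> carrier (M' (q i))" for i m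
  proof -
    have "\<phi> i \<zero>\<^bsub>M' (q i)\<^esub> = \<zero>\<^bsub>M i\<^esub>"
      using \<phi>[OF that(1)] M[OF that(1)] M'[OF q_in[OF that(1)]]
      by (auto simp: module_isos_def intro: linear_map_zero)
    thus ?thesis
      using \<phi>_bij[OF that(1)] that(2) module_zero_closed[OF M'[OF q_in[OF that(1)]]]
      by (metis bij_betw_def inj_onD)
  qed
  define T where "T u = (\<lambda>i\<in>I. \<phi> i (u (q i)))" for u
  have supp: "q ` {i \<in> I. T u i \<noteq> \<zero>\<^bsub>M i\<^esub>} = {i \<in> I'. u i \<noteq> \<zero>\<^bsub>M' i\<^esub>}"
    if "u \<in> (\<Pi>\<^sub>E i\<in>I'. carrier (M' i))" for u
  proof -
    have "{i \<in> I. T u i \<noteq> \<zero>\<^bsub>M i\<^esub>} = {i \<in> I. u (q i) \<noteq> \<zero>\<^bsub>M' (q i)\<^esub>}"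
      using that q_in \<phi>_zero by (auto simp: T_def PiE_def Pi_def)
    thus ?thesis using q by (auto simp: bij_betw_def)
  qed
  have q_inj: "inj_on q K" if "K \<subseteq> I" for K
    using q that by (auto simp: bij_betw_def intro: inj_on_subset)
  have T: "bij_betw T (carrier (direct_sum I' M')) (carrier (direct_sum I M))"
  proof (rule bij_betw_imageI)
    show "inj_on T (carrier (direct_sum I' M'))"
    proof (rule inj_onI)
      fix u v
      assume u: "u \<in> carrier (direct_sum I' M')" and v: "v \<in> carrier (direct_sum I' M')"
        and eq: "T u = T v"
      show "u = v"
      proof (rule extensionalityI[of _ I'])
        fix i' assume i': "i' \<in> I'"
        then obtain i where i: "i \<in> I" "i' = q i" using q by (auto simp: bij_betw_def)
        have "\<phi> i (u i') = \<phi> i (v i')" using fun_cong[OF eq, of i] i by (simp add: T_def)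
        thus "u i' = v i'"
          using \<phi>_bij[OF i(1)] i u v i' by (auto simp: bij_betw_def direct_sum_carrier dest: inj_onD)
      qed (use u v in \<open>auto simp: direct_sum_carrier PiE_def\<close>)
    qed
    show "T ` carrier (direct_sum I' M') = carrier (direct_sum I M)"
    proof (intro equalityI subsetI)
      fix w assume "w \<in> T ` carrier (direct_sum I' M')"
      then obtain u where u: "u \<in> carrier (direct_sum I' M')" "w = T u" by blast
      have "finite {i \<in> I. w i \<noteq> \<zero>\<^bsub>M i\<^esub>}"
        by (rule finite_imageD[of q], unfold u(2), subst supp)
          (use u q_inj in \<open>auto simp: direct_sum_carrier\<close>)
      thus "w \<in> carrier (direct_sum I M)"
        using u q_in bij_betwE[OF \<phi>_bij] by (auto simp: direct_sum_carrier T_def)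
    next
      fix w assume w: "w \<in> carrier (direct_sum I M)"
      define p where "p = inv_into I q"
      have p: "p i' \<in> I" "q (p i') = i'" if "i' \<in> I'" for i'
        using q that by (auto simp: p_def bij_betw_def inv_into_into f_inv_into_f)
      have pq: "p (q i) = i" if "i \<in> I" for i
        using q that by (simp add: p_def bij_betw_def)
      define u where
        "u = (\<lambda>i'\<in>I'. inv_into (carrier (M' i')) (\<phi> (p i')) (w (p i')))"
      have u_in: "u i' \<in> carrier (M' i')" and \<phi>_u: "\<phi> (p i') (u i') = w (p i')" if "i' \<in> I'" for i'
      proof -
        have "w (p i') \<in> \<phi> (p i') ` carrier (M' i')"
          using \<phi>_bij[OF p(1)[OF that]] p[OF that] w
          by (auto simp: bij_betw_def direct_sum_carrier)
        thus "u i' \<in> carrier (M' i')" "\<phi> (p i') (u i') = w (p i')"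
          using that by (auto simp: u_def inv_into_into f_inv_into_f)
      qed
      have Tu: "T u = w"
      proof (rule extensionalityI[of _ I])
        fix i assume "i \<in> I"
        thus "T u i = w i" using \<phi>_u[OF q_in] pq by (simp add: T_def)
      qed (use w in \<open>auto simp: T_def direct_sum_carrier PiE_def\<close>)
      have u_PiE: "u \<in> (\<Pi>\<^sub>E i\<in>I'. carrier (M' i))" using u_in by (auto simp: u_def)
      have "finite {i \<in> I'. u i \<noteq> \<zero>\<^bsub>M' i\<^esub>}"
        using w by (simp add: supp[OF u_PiE, symmetric] Tu direct_sum_carrier)
      hence "u \<in> carrier (direct_sum I' M')" using u_PiE by (simp add: direct_sum_carrier)
      thus "w \<in> T ` carrier (direct_sum I' M')" using Tu by blast
    qed
  qed
  have commute: "\<psi> (copairing I' M' N' h' u) = copairing I M N h (T u)"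
    if u: "u \<in> carrier (direct_sum I' M')" for u
  proof -
    let ?K = "{i \<in> I. T u i \<noteq> \<zero>\<^bsub>M i\<^esub>}"
    have u': "u \<in> (\<Pi>\<^sub>E i\<in>I'. carrier (M' i))" "finite {i \<in> I'. u i \<noteq> \<zero>\<^bsub>M' i\<^esub>}"
      using u by (auto simp: direct_sum_carrier)
    have h'u: "h' i (u i) \<in> carrier N'" if "i \<in> I'" for i using h'[OF that] u' that by auto
    have \<psi>_lin: "\<psi> \<in> linear_maps R N' N" using \<psi> by (simp add: module_isos_def)
    have "\<psi> (copairing I' M' N' h' u) =
      finsum N (\<lambda>i. \<psi> (h' i (u i))) {i \<in> I'. u i \<noteq> \<zero>\<^bsub>M' i\<^esub>}"
      unfolding copairing_def
      by (rule linear_map_finsum[OF \<psi>_lin N' N]) (use u' h'u in auto)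
    also have "\<dots> = finsum N (\<lambda>i. \<psi> (h' i (u i))) (q ` ?K)"
      by (simp only: supp[OF u'(1)])
    also have "\<dots> = finsum N (\<lambda>i. \<psi> (h' (q i) (u (q i)))) ?K"
      by (rule N.M.finsum_reindex)
        (use q_inj q_in h'u linear_mapsD(1)[OF \<psi>_lin] in auto)
    also have "\<dots> = finsum N (\<lambda>i. h i (T u i)) ?K"
    proof (rule N.M.finsum_cong'[symmetric, OF refl])
      show "(\<lambda>i. \<psi> (h' (q i) (u (q i)))) \<in> ?K \<rightarrow> carrier N"
        using q_in h'u linear_mapsD(1)[OF \<psi>_lin] by auto
      show "h i (T u i) = \<psi> (h' (q i) (u (q i)))" if "i \<in> ?K" for i
        using that square[of i "u (q i)"] PiE_mem[OF u'(1) q_in[of i]] by (simp add: T_def)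
    qed
    finally show ?thesis by (simp add: copairing_def)
  qed
  have "bij_betw (copairing I M N h \<circ> T) (carrier (direct_sum I' M')) (carrier N)"
    using T S by (rule bij_betw_trans)
  hence "bij_betw (\<psi> \<circ> copairing I' M' N' h') (carrier (direct_sum I' M')) (carrier N)"
    by (rule iffD2[OF bij_betw_cong, rotated]) (simp add: commute)
  moreover have "bij_betw \<psi> (carrier N') (carrier N)" using \<psi> by (simp add: module_isos_def)
  moreover have "copairing I' M' N' h' ` carrier (direct_sum I' M') \<subseteq> carrier N'"
    using h' by (auto intro!: copairing_closed[OF N'] simp: direct_sum_carrier)
  ultimately show ?thesis by (simp add: bij_betw_comp_iff2)
qed

section \<open>Local form of the covering condition\<close>

lemma (in k_functor) star_map_linear:
  assumes "x \<in> Obj C"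
  shows "star_map C B F x \<in> linear_maps R (star C x) (star B (fobj F x))"
  unfolding star_map_def star_def
  by (intro map_prod_linear direct_sum_map_linear)
    (use assms source.Hom_module target.Hom_module fobj_closed fmor_linear in auto)

text \<open>
  Linearity of a star map is automatic. As both factors of the star contain a zero, the product map
  is bijective only if each of its two factors is, and these are sorted by fibres as above.
\<close>

lemma (in k_functor) star_map_iso_iff:
  assumes x: "x \<in> Obj C"
  shows "star_map C B F x \<in> module_isos R (star C x) (star B (fobj F x)) \<longleftrightarrow>
    (\<forall>b\<in>Obj B.
      bij_betw (copairing {x' \<in> Obj C. fobj F x' = b} (\<lambda>x'. Hom C x x') (Hom B (fobj F x) b)
          (\<lambda>x'. fmor F x x'))
        (carrier (direct_sum {x' \<in> Obj C. fobj F x' = b} (\<lambda>x'. Hom C x x')))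
        (carrier (Hom B (fobj F x) b)) \<and>
      bij_betw (copairing {x' \<in> Obj C. fobj F x' = b} (\<lambda>x'. Hom C x' x) (Hom B b (fobj F x))
          (\<lambda>x'. fmor F x' x))
        (carrier (direct_sum {x' \<in> Obj C. fobj F x' = b} (\<lambda>x'. Hom C x' x)))
        (carrier (Hom B b (fobj F x))))"
proof -
  note facts = x source.Hom_module target.Hom_module fobj_closed fmor_linear
  have "carrier (direct_sum (Obj C) (\<lambda>y. Hom C x y)) \<noteq> {}"
    "carrier (direct_sum (Obj C) (\<lambda>y. Hom C y x)) \<noteq> {}"
    using x source.Hom_module by (auto intro!: direct_sum_nonempty module_zero_closed)
  note split = map_prod_bij_betw_iff[OF this]
  have out: "bij_betw (direct_sum_map (Obj C) (\<lambda>y. Hom C x y) (Obj B) (\<lambda>z. Hom B (fobj F x) z)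
      (fobj F) (\<lambda>y. fmor F x y))
      (carrier (direct_sum (Obj C) (\<lambda>y. Hom C x y)))
      (carrier (direct_sum (Obj B) (\<lambda>z. Hom B (fobj F x) z))) \<longleftrightarrow>
    (\<forall>b\<in>Obj B. bij_betw (copairing {x' \<in> Obj C. fobj F x' = b} (\<lambda>x'. Hom C x x')
          (Hom B (fobj F x) b) (\<lambda>x'. fmor F x x'))
        (carrier (direct_sum {x' \<in> Obj C. fobj F x' = b} (\<lambda>x'. Hom C x x')))
        (carrier (Hom B (fobj F x) b)))"
    by (rule direct_sum_map_bij_iff) (use facts in auto)
  have inc: "bij_betw (direct_sum_map (Obj C) (\<lambda>y. Hom C y x) (Obj B) (\<lambda>z. Hom B z (fobj F x))
      (fobj F) (\<lambda>y. fmor F y x))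
      (carrier (direct_sum (Obj C) (\<lambda>y. Hom C y x)))
      (carrier (direct_sum (Obj B) (\<lambda>z. Hom B z (fobj F x)))) \<longleftrightarrow>
    (\<forall>b\<in>Obj B. bij_betw (copairing {x' \<in> Obj C. fobj F x' = b} (\<lambda>x'. Hom C x' x)
          (Hom B b (fobj F x)) (\<lambda>x'. fmor F x' x))
        (carrier (direct_sum {x' \<in> Obj C. fobj F x' = b} (\<lambda>x'. Hom C x' x)))
        (carrier (Hom B b (fobj F x))))"
    by (rule direct_sum_map_bij_iff) (use facts in auto)
  show ?thesis
    using star_map_linear[OF x]
    by (simp add: module_isos_def star_map_def star_def split out inc ball_conj_distrib)
qed

section \<open>Fibre products\<close>

lemma fibre_product_simps [simp]:
  "(x, y) \<in> Obj (fibre_product C D F G) \<longleftrightarrow> x \<in> Obj C \<and> y \<in> Obj D \<and> fobj F x = fobj G y"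
  "(f, g) \<in> carrier (Hom (fibre_product C D F G) (x, y) (x', y')) \<longleftrightarrow>
    f \<in> carrier (Hom C x x') \<and> g \<in> carrier (Hom D y y') \<and> fmor F x x' f = fmor G y y' g"
  "(f, g) \<oplus>\<^bsub>Hom (fibre_product C D F G) (x, y) (x', y')\<^esub> (f', g') =
    (f \<oplus>\<^bsub>Hom C x x'\<^esub> f', g \<oplus>\<^bsub>Hom D y y'\<^esub> g')"
  "a \<odot>\<^bsub>Hom (fibre_product C D F G) (x, y) (x', y')\<^esub> (f, g) =
    (a \<odot>\<^bsub>Hom C x x'\<^esub> f, a \<odot>\<^bsub>Hom D y y'\<^esub> g)"
  "Id (fibre_product C D F G) (x, y) = (Id C x, Id D y)"
  "Comp (fibre_product C D F G) (x, y) (x', y') (x'', y'') (f', g') (f, g) =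
    (Comp C x x' x'' f' f, Comp D y y' y'' g' g)"
  by (simp_all add: fibre_product_def)

lemma proj_right_simps [simp]: "fobj proj_right = snd" "fmor proj_right z w = snd"
  by (simp_all add: proj_right_def)

locale k_cospan = F: k_functor R C B F + G: k_functor R D B G
  for R :: "('k, 'r) ring_scheme"
    and C :: "('c, 'k, 'm) kcat" and D :: "('d, 'k, 'l) kcat" and B :: "('b, 'k, 'n) kcat"
    and F :: "('c, 'm, 'b, 'n) kfun" and G :: "('d, 'l, 'b, 'n) kfun"
begin

abbreviation P where "P \<equiv> fibre_product C D F G"

lemma fibre_product_Hom_module:
  assumes "z \<in> Obj P" "w \<in> Obj P"
  shows "module R (Hom P z w)"
proof -
  obtain x y x' y' where [simp]: "z = (x, y)" "w = (x', y')" by (metis surj_pair)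
  have obj: "x \<in> Obj C" "x' \<in> Obj C" "y \<in> Obj D" "y' \<in> Obj D"
    "fobj F x = fobj G y" "fobj F x' = fobj G y'" using assms by auto
  have "fmor F x x' \<in> linear_maps R (Hom C x x') (Hom B (fobj G y) (fobj G y'))"
    using F.fmor_linear obj by metis
  moreover have "fmor G y y' \<in> linear_maps R (Hom D y y') (Hom B (fobj G y) (fobj G y'))"
    using G.fmor_linear obj by metis
  moreover have "module R (Hom C x x')" "module R (Hom D y y')"
    "module R (Hom B (fobj G y) (fobj G y'))"
    using obj(1-4) F.source.Hom_module G.source.Hom_module F.target.Hom_module G.fobj_closed
    by blast+
  ultimately have "module R ((module_prod (Hom C x x') (Hom D y y'))
    \<lparr>carrier := {(f, g). f \<in> carrier (Hom C x x') \<and> g \<in> carrier (Hom D y y') \<and>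
      fmor F x x' f = fmor G y y' g}\<rparr>)"
    by (intro module_equalizer)
  thus ?thesis by (simp add: fibre_product_def)
qed

lemma k_category_fibre_product: "k_category R P"
proof (intro k_category.intro k_category_axioms.intro F.source.is_cring)
  show "module R (Hom P z w)" if "z \<in> Obj P" "w \<in> Obj P" for z w
    using that by (rule fibre_product_Hom_module)
next
  fix z assume "z \<in> Obj P"
  thus "Id P z \<in> carrier (Hom P z z)"
    using F.source.Id_closed G.source.Id_closed F.fmor_Id G.fmor_Id by (cases z) auto
next
  fix z1 z2 z3 k
  assume *: "z1 \<in> Obj P" "z2 \<in> Obj P" "z3 \<in> Obj P" "k \<in> carrier (Hom P z1 z2)"
  obtain x1 y1 x2 y2 x3 y3 f g where
    [simp]: "z1 = (x1, y1)" "z2 = (x2, y2)" "z3 = (x3, y3)" "k = (f, g)"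
    by (metis surj_pair)
  have linC: "(\<lambda>f'. Comp C x1 x2 x3 f' f) \<in> linear_maps R (Hom C x2 x3) (Hom C x1 x3)"
    using * by (intro F.source.Comp_linear_left) auto
  have linD: "(\<lambda>g'. Comp D y1 y2 y3 g' g) \<in> linear_maps R (Hom D y2 y3) (Hom D y1 y3)"
    using * by (intro G.source.Comp_linear_left) auto
  show "(\<lambda>k'. Comp P z1 z2 z3 k' k) \<in> linear_maps R (Hom P z2 z3) (Hom P z1 z3)"
    by (rule linear_mapsI)
      (use * in \<open>auto simp: linear_mapsD[OF linC] linear_mapsD[OF linD] F.fmor_Comp G.fmor_Comp\<close>)
next
  fix z1 z2 z3 k
  assume *: "z1 \<in> Obj P" "z2 \<in> Obj P" "z3 \<in> Obj P" "k \<in> carrier (Hom P z2 z3)"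
  obtain x1 y1 x2 y2 x3 y3 f g where
    [simp]: "z1 = (x1, y1)" "z2 = (x2, y2)" "z3 = (x3, y3)" "k = (f, g)"
    by (metis surj_pair)
  have linC: "(\<lambda>f'. Comp C x1 x2 x3 f f') \<in> linear_maps R (Hom C x1 x2) (Hom C x1 x3)"
    using * by (intro F.source.Comp_linear_right) auto
  have linD: "(\<lambda>g'. Comp D y1 y2 y3 g g') \<in> linear_maps R (Hom D y1 y2) (Hom D y1 y3)"
    using * by (intro G.source.Comp_linear_right) auto
  show "(\<lambda>k'. Comp P z1 z2 z3 k k') \<in> linear_maps R (Hom P z1 z2) (Hom P z1 z3)"
    by (rule linear_mapsI)
      (use * in \<open>auto simp: linear_mapsD[OF linC] linear_mapsD[OF linD] F.fmor_Comp G.fmor_Comp\<close>)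
next
  fix z w k assume "z \<in> Obj P" "w \<in> Obj P" "k \<in> carrier (Hom P z w)"
  thus "Comp P z w w (Id P w) k = k"
    by (cases z; cases w; cases k) (auto simp: F.source.Id_left G.source.Id_left)
next
  fix z w k assume "z \<in> Obj P" "w \<in> Obj P" "k \<in> carrier (Hom P z w)"
  thus "Comp P z z w k (Id P z) = k"
    by (cases z; cases w; cases k) (auto simp: F.source.Id_right G.source.Id_right)
next
  fix z1 z2 z3 z4 k1 k2 k3
  assume "z1 \<in> Obj P" "z2 \<in> Obj P" "z3 \<in> Obj P" "z4 \<in> Obj P"
    "k1 \<in> carrier (Hom P z1 z2)" "k2 \<in> carrier (Hom P z2 z3)" "k3 \<in> carrier (Hom P z3 z4)"
  thus "Comp P z1 z2 z4 (Comp P z2 z3 z4 k3 k2) k1 = Comp P z1 z3 z4 k3 (Comp P z1 z2 z3 k2 k1)"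
    by (cases z1; cases z2; cases z3; cases z4; cases k1; cases k2; cases k3)
      (auto simp: F.source.Comp_assoc G.source.Comp_assoc)
qed

lemma k_functor_proj_right: "k_functor R P D proj_right"
proof (intro k_functor.intro k_functor_axioms.intro k_category_fibre_product;
    (unfold proj_right_simps)?)
  show "k_category R D" by (rule G.source.k_category_axioms)
next
  fix z assume "z \<in> Obj P"
  thus "snd z \<in> Obj D" by (cases z) auto
next
  fix z w
  show "snd \<in> linear_maps R (Hom P z w) (Hom D (snd z) (snd w))"
    by (cases z; cases w; rule linear_mapsI) auto
next
  fix z
  show "snd (Id P z) = Id D (snd z)" by (cases z) auto
next
  fix z1 z2 z3 k1 k2
  show "snd (Comp P z1 z2 z3 k2 k1) = Comp D (snd z1) (snd z2) (snd z3) (snd k2) (snd k1)"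
    by (cases z1; cases z2; cases z3; cases k1; cases k2) auto
qed

text \<open>
  Given \<open>f : x \<rightarrow> x'\<close>, full faithfulness provides exactly one \<open>g : y \<rightarrow> y'\<close> with \<open>G g = F f\<close>.
\<close>

lemma fst_module_iso:
  assumes ff: "fully_faithful D B G" and zw: "(x, y) \<in> Obj P" "(x', y') \<in> Obj P"
  shows "fst \<in> module_isos R (Hom P (x, y) (x', y')) (Hom C x x')"
proof -
  have obj: "x \<in> Obj C" "x' \<in> Obj C" "y \<in> Obj D" "y' \<in> Obj D"
    "fobj F x = fobj G y" "fobj F x' = fobj G y'" using zw by auto
  have G: "bij_betw (fmor G y y') (carrier (Hom D y y')) (carrier (Hom B (fobj F x) (fobj F x')))"
    using ff obj by (simp add: fully_faithful_def)
  have "bij_betw fst (carrier (Hom P (x, y) (x', y'))) (carrier (Hom C x x'))"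
  proof (rule bij_betw_imageI)
    show "inj_on fst (carrier (Hom P (x, y) (x', y')))"
      using G by (auto simp: inj_on_def bij_betw_def)
    show "fst ` carrier (Hom P (x, y) (x', y')) = carrier (Hom C x x')"
    proof (intro equalityI subsetI)
      fix f assume f: "f \<in> carrier (Hom C x x')"
      hence "fmor F x x' f \<in> carrier (Hom B (fobj F x) (fobj F x'))"
        using linear_mapsD(1)[OF F.fmor_linear] obj by metis
      then obtain g where "g \<in> carrier (Hom D y y')" "fmor F x x' f = fmor G y y' g"
        using G by (auto simp: bij_betw_def)
      thus "f \<in> fst ` carrier (Hom P (x, y) (x', y'))"
        using f by (intro image_eqI[of _ _ "(f, g)"]) auto
    qed auto
  qed
  moreover have "fst \<in> linear_maps R (Hom P (x, y) (x', y')) (Hom C x x')"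
    by (rule linear_mapsI) auto
  ultimately show ?thesis by (simp add: module_isos_def)
qed

lemma fully_faithful_module_iso:
  assumes "fully_faithful D B G" "y \<in> Obj D" "y' \<in> Obj D"
  shows "fmor G y y' \<in> module_isos R (Hom D y y') (Hom B (fobj G y) (fobj G y'))"
  using assms G.fmor_linear by (simp add: module_isos_def fully_faithful_def)

lemma fibre_bij:
  "bij_betw (\<lambda>x. (x, y)) {x \<in> Obj C. fobj F x = fobj G y} {z \<in> Obj P. snd z = y}"
  if "y \<in> Obj D"
  by (rule bij_betwI[where g = fst]) (use that in auto)

lemma covering_proj_right:
  assumes cov: "covering R C B F" and ff: "fully_faithful D B G"
  shows "covering R P D proj_right"
proof -
  interpret pr: k_functor R P D proj_right by (rule k_functor_proj_right)
  have surj: "snd ` Obj P = Obj D"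
  proof (intro equalityI subsetI)
    fix y assume y: "y \<in> Obj D"
    then obtain x where "x \<in> Obj C" "fobj F x = fobj G y"
      using cov G.fobj_closed[OF y] by (metis covering_def imageE)
    thus "y \<in> snd ` Obj P" using y by (intro image_eqI[of _ _ "(x, y)"]) auto
  qed (use pr.fobj_closed in auto)
  have iso: "star_map P D proj_right z \<in> module_isos R (star P z) (star D (snd z))"
    if z: "z \<in> Obj P" for z
  proof -
    obtain x y where z_eq: "z = (x, y)" by (cases z)
    hence obj: "x \<in> Obj C" "y \<in> Obj D" "fobj F x = fobj G y" using z by auto
    have snd_z: "snd z = y" by (simp add: z_eq)
    have F_iso: "star_map C B F x \<in> module_isos R (star C x) (star B (fobj F x))"
      using cov obj(1) F.fobj_closed by (simp add: covering_def)
    note F_bij = F_iso[unfolded F.star_map_iso_iff[OF obj(1)], rule_format]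
    have z_Hom: "module R (Hom P z w)" "module R (Hom P w z)" if "w \<in> Obj P" for w
      using z that by (auto intro: fibre_product_Hom_module)
    have snd_Hom: "snd \<in> carrier (Hom P z w) \<rightarrow> carrier (Hom D y y')"
      "snd \<in> carrier (Hom P w z) \<rightarrow> carrier (Hom D y' y)" if "snd w = y'" for w y'
      using that by (cases w; auto simp: z_eq)+
    show ?thesis
    proof (rule iffD2[OF pr.star_map_iso_iff[OF z, unfolded proj_right_simps]], intro ballI conjI)
      fix y' assume y': "y' \<in> Obj D"
      have Gy': "fobj G y' \<in> Obj B" "fobj F x \<in> Obj B"
        using G.fobj_closed F.fobj_closed y' obj(1) by auto
      have fibre: "(x', y') \<in> Obj P" if "x' \<in> {x' \<in> Obj C. fobj F x' = fobj G y'}" for x'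
        using that y' by simp
      show "bij_betw (copairing {w \<in> Obj P. snd w = y'} (\<lambda>w. Hom P z w)
          (Hom D (snd z) y') (\<lambda>w. snd))
        (carrier (direct_sum {w \<in> Obj P. snd w = y'} (\<lambda>w. Hom P z w)))
        (carrier (Hom D (snd z) y'))"
        unfolding snd_z
      proof (rule copairing_bij_transfer[where R = R and q = "\<lambda>x'. (x', y')"
            and \<phi> = "\<lambda>_. fst" and \<psi> = "fmor G y y'"
            and I = "{x' \<in> Obj C. fobj F x' = fobj G y'}" and M = "\<lambda>x'. Hom C x x'"
            and N = "Hom B (fobj F x) (fobj G y')" and h = "\<lambda>x'. fmor F x x'"])
        show "bij_betw (copairing {x' \<in> Obj C. fobj F x' = fobj G y'} (\<lambda>x'. Hom C x x')
            (Hom B (fobj F x) (fobj G y')) (\<lambda>x'. fmor F x x'))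
          (carrier (direct_sum {x' \<in> Obj C. fobj F x' = fobj G y'} (\<lambda>x'. Hom C x x')))
          (carrier (Hom B (fobj F x) (fobj G y')))"
          using F_bij[OF Gy'(1)] by (rule conjunct1)
        show "bij_betw (\<lambda>x'. (x', y')) {x' \<in> Obj C. fobj F x' = fobj G y'}
            {w \<in> Obj P. snd w = y'}"
          by (rule fibre_bij[OF y'])
        show "fmor G y y' \<in> module_isos R (Hom D y y') (Hom B (fobj F x) (fobj G y'))"
          using fully_faithful_module_iso[OF ff] obj y' by simp
        fix x' m assume "x' \<in> {x' \<in> Obj C. fobj F x' = fobj G y'}"
        note fibre = fibre[OF this]
        show "fst \<in> module_isos R (Hom P z (x', y')) (Hom C x x')"
          using fst_module_iso[OF ff] z fibre unfolding z_eq by blast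
        show "fmor G y y' (snd m) = fmor F x x' (fst m)" if "m \<in> carrier (Hom P z (x', y'))"
          using that by (cases m) (simp add: z_eq)
      qed (use z_Hom snd_Hom F.source.Hom_module G.source.Hom_module F.target.Hom_module
          y' obj(1,2) Gy' in blast)+
      show "bij_betw (copairing {w \<in> Obj P. snd w = y'} (\<lambda>w. Hom P w z)
          (Hom D y' (snd z)) (\<lambda>w. snd))
        (carrier (direct_sum {w \<in> Obj P. snd w = y'} (\<lambda>w. Hom P w z)))
        (carrier (Hom D y' (snd z)))"
        unfolding snd_z
      proof (rule copairing_bij_transfer[where R = R and q = "\<lambda>x'. (x', y')"
            and \<phi> = "\<lambda>_. fst" and \<psi> = "fmor G y' y"
            and I = "{x' \<in> Obj C. fobj F x' = fobj G y'}" and M = "\<lambda>x'. Hom C x' x"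
            and N = "Hom B (fobj G y') (fobj F x)" and h = "\<lambda>x'. fmor F x' x"])
        show "bij_betw (copairing {x' \<in> Obj C. fobj F x' = fobj G y'} (\<lambda>x'. Hom C x' x)
            (Hom B (fobj G y') (fobj F x)) (\<lambda>x'. fmor F x' x))
          (carrier (direct_sum {x' \<in> Obj C. fobj F x' = fobj G y'} (\<lambda>x'. Hom C x' x)))
          (carrier (Hom B (fobj G y') (fobj F x)))"
          using F_bij[OF Gy'(1)] by (rule conjunct2)
        show "bij_betw (\<lambda>x'. (x', y')) {x' \<in> Obj C. fobj F x' = fobj G y'}
            {w \<in> Obj P. snd w = y'}"
          by (rule fibre_bij[OF y'])
        show "fmor G y' y \<in> module_isos R (Hom D y' y) (Hom B (fobj G y') (fobj F x))"
          using fully_faithful_module_iso[OF ff] obj y' by simp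
        fix x' m assume "x' \<in> {x' \<in> Obj C. fobj F x' = fobj G y'}"
        note fibre = fibre[OF this]
        show "fst \<in> module_isos R (Hom P (x', y') z) (Hom C x' x)"
          using fst_module_iso[OF ff] z fibre unfolding z_eq by blast
        show "fmor G y' y (snd m) = fmor F x' x (fst m)" if "m \<in> carrier (Hom P (x', y') z)"
          using that by (cases m) (simp add: z_eq)
      qed (use z_Hom snd_Hom F.source.Hom_module G.source.Hom_module F.target.Hom_module
          y' obj(1,2) Gy' in blast)+
    qed
  qed
  show ?thesis
    unfolding covering_def proj_right_simps using k_functor_proj_right surj iso by blast
qed

end

theorem theorem3p3:
  fixes R :: "('k, 'r) ring_scheme"
    and C :: "('c, 'k, 'm) kcat" and D :: "('d, 'k, 'l) kcat" and B :: "('b, 'k, 'n) kcat"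
    and F :: "('c, 'm, 'b, 'n) kfun" and G :: "('d, 'l, 'b, 'n) kfun"
  assumes "cring R"
    and "k_functor R C B F"
    and "k_functor R D B G"
    and "covering R C B F"
    and "fully_faithful D B G"
  shows "covering R (fibre_product C D F G) D proj_right"
proof -
  interpret k_cospan R C D B F G by (rule k_cospan.intro) fact+
  show ?thesis using assms(4,5) by (rule covering_proj_right)
qed

end
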